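(* Let $q=p_1^{\alpha_1}=p_2^{\alpha_2}$ with $0<|q|<1$, where $\alpha_1>0$, $\alpha_2>0$ are real and $\alpha_1+\alpha_2<1$. Let $a_1,a_2,b_1,b_2\in\mathbb{C}$ be such that $(p_j^{a_j+1};p_j)_\infty\neq0$ for $j=1,2$, and let $z\in\mathbb{C}\setminus\{0\}$ with $z\notin\{-q^{x}:x\in\mathbb{R}\}$. Then $$\sum_{n=-\infty}^\infty \left[{a_1\atop b_1+\alpha_1 n}\right]_{p_1}\left[{a_2\atop b_2+\alpha_2 n}\right]_{p_2}\frac{1}{(-zq^n,-q^{1-n}/z;q)_\infty}=\int_{-\infty}^\infty\left[{a_1\atop b_1+\alpha_1 x}\right]_{p_1}\left[{a_2\atop b_2+\alpha_2 x}\right]_{p_2}\frac{dx}{\left(-zq^x,-q^{1-x}/z;q\right)_\infty}.$$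
   Context: For complex $c$ and $|r|<1$, $(c;r)_\infty=\prod_{k=0}^\infty(1-cr^k)$ and $(c_1,\dots,c_m;r)_\infty=\prod_{j=1}^m(c_j;r)_\infty$. A logarithm $\ln q$ is fixed (the real one if $0<q<1$), and $q^s=e^{s\ln q}$, $p_j=e^{(\ln q)/\alpha_j}$, $p_j^s=e^{s(\ln q)/\alpha_j}$ for complex $s$. The $q$-Gamma function is $\Gamma_r(x)=\frac{(r;r)_\infty}{(r^x;r)_\infty}(1-r)^{1-x}$, and the $q$-binomial coefficient with base $r$ is $$\left[{a\atop b}\right]_r=\frac{\Gamma_r(a+1)}{\Gamma_r(b+1)\Gamma_r(a-b+1)}=\frac{(r^{b+1},r^{a-b+1};r)_\infty}{(r,r^{a+1};r)_\infty},$$ the last expression being used as its value for all $b$ (with $1/\Gamma_r$ equal to $0$ at poles of $\Gamma_r$). *)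

theory Defs
  imports "HOL-Analysis.Analysis"
begin

text \<open>\<open>qpoch c r\<close> is $(c;r)_\infty$, meaningful for $|r| < 1$.\<close>

definition qpoch :: "complex \<Rightarrow> complex \<Rightarrow> complex" where
  "qpoch c r = (\<Prod>k. 1 - c * r ^ k)"

text \<open>
  A complex power $r^s$ depends on the choice of a logarithm \<open>l\<close> of \<open>r\<close>. The functions
  below therefore take \<open>l\<close> as their parameter; the base is \<open>r = exp l\<close>, with
  $|r| < 1$ iff \<open>Re l < 0\<close>.
\<close>

definition pow_of_log :: "complex \<Rightarrow> complex \<Rightarrow> complex" where
  "pow_of_log l s = exp (s * l)"

text \<open>
  As $|r| < 1$, the number $1 - r$ lies in the right half-plane, and its power is the
  principal one. At the poles of $\Gamma_r$ division by zero gives the value 0, so that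
  also \<open>1 / qGamma l x = 0\<close> there.
\<close>

definition qGamma :: "complex \<Rightarrow> complex \<Rightarrow> complex" where
  "qGamma l x = qpoch (exp l) (exp l) / qpoch (pow_of_log l x) (exp l) * (1 - exp l) powr (1 - x)"

definition qbinom :: "complex \<Rightarrow> complex \<Rightarrow> complex \<Rightarrow> complex" where
  "qbinom l a b =
     (qpoch (pow_of_log l (b + 1)) (exp l) * qpoch (pow_of_log l (a - b + 1)) (exp l)) /
     (qpoch (exp l) (exp l) * qpoch (pow_of_log l (a + 1)) (exp l))"

lemma qpoch_self_nonzero:
  assumes "norm r < 1"
  shows "qpoch r r \<noteq> 0"
proof -
  have "summable (\<lambda>k. norm (r * r ^ k))"
    using assms by (simp add: norm_mult norm_power summable_mult summable_geometric)
  hence "summable (\<lambda>k. norm ((1 - r * r ^ k) - 1))"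
    by simp
  hence "convergent_prod (\<lambda>k. 1 - r * r ^ k)"
    by (intro abs_convergent_prod_imp_convergent_prod)
       (simp add: abs_convergent_prod_conv_summable)
  moreover have "1 - r * r ^ k \<noteq> 0" for k
  proof
    assume "1 - r * r ^ k = 0"
    hence "norm r ^ Suc k = 1"
      by (metis eq_iff_diff_eq_0 norm_one norm_power power_Suc)
    moreover have "norm r ^ Suc k < 1"
      using assms power_Suc_le_self [of "norm r" k] by simp
    ultimately show False by simp
  qed
  ultimately show ?thesis
    unfolding qpoch_def by (intro prodinf_nonzero) auto
qed

lemma qbinom_eq_qGamma:
  assumes "Re l < 0"
  shows "qbinom l a b = qGamma l (a + 1) / (qGamma l (b + 1) * qGamma l (a - b + 1))"
proof -
  have r: "norm (exp l) < 1"
    using assms by simp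
  hence nz: "1 - exp l \<noteq> 0"
    by (metis norm_one less_irrefl right_minus_eq)
  have "(1 - exp l) powr (1 - (b + 1)) * (1 - exp l) powr (1 - (a - b + 1)) =
        (1 - exp l) powr (1 - (a + 1))"
    by (simp add: powr_add [symmetric])
  moreover have "(1 - exp l) powr s \<noteq> 0" for s
    using nz by simp
  ultimately show ?thesis
    using qpoch_self_nonzero [OF r]
    unfolding qbinom_def qGamma_def by (simp add: divide_simps)
qed

end

theory Submission
  imports Defs
begin

text \<open>
  Put \<open>u = q\<^sup>x\<close>. The numerator of the summand is \<open>C N(u)\<close> with \<open>C\<close> constant and \<open>N(u) = \<Sum> c\<^sub>i u\<^bsup>d i\<^esup>\<close> a product of
  four \<open>q\<close>-shifted factorials, expanded by Euler's formula, and the denominator is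
  \<open>\<theta>(z u) = (- z u, - q / (z u); q)\<^sub>\<infinity>\<close>. Quasi-periodicity of \<open>\<theta>\<close> turns the sum over \<open>x + n\<close>, with \<open>n\<close>
  ranging over the integers, into \<open>C / \<theta>(z u)\<close> times the double sum of
  \<open>c\<^sub>i u\<^bsup>d i\<^esup> q\<^bsup>n d i\<^esup> q\<^bsup>n(n-1)/2\<^esup> (z u)\<^bsup>n\<^esup>\<close>. Shifting \<open>n\<close> by \<open>d i\<close> separates the variables; by the Jacobi
  triple product the factor \<open>\<theta>(z u)\<close> comes out and cancels. Hence the periodization of the summand does not
  depend on \<open>x\<close>, so its value at 0 equals its integral over the unit interval.
\<close>

section \<open>Gaussian sums and Euler's expansion\<close>

text \<open>The division is exact (\<open>two_tri\<close>), so \<open>q powi tri n\<close> is a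
  genuine integer power and involves no choice of a square root of \<open>q\<close>.\<close>

definition tri :: "int \<Rightarrow> int" where
  "tri n = n * (n - 1) div 2"

lemma two_tri: "2 * tri n = n * (n - 1)"
  unfolding tri_def by (rule dvd_mult_div_cancel) auto

text \<open>The cross term \<open>m * n\<close> is the source of both the quasi-periodicity of theta
  and the separation of variables in the double series.\<close>

lemma tri_add: "tri (m + n) = tri m + tri n + m * n"
proof -
  have "2 * tri (m + n) = 2 * (tri m + tri n + m * n)"
    unfolding distrib_left two_tri by (simp add: algebra_simps)
  thus ?thesis by simp
qed

lemma of_int_tri: "real_of_int (tri n) = (of_int n ^ 2 - of_int n) / 2"
proof -
  have "2 * real_of_int (tri n) = of_int (2 * tri n)"
    by simp
  also have "\<dots> = of_int n ^ 2 - of_int n"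
    unfolding two_tri by (simp add: algebra_simps power2_eq_square)
  finally show ?thesis by simp
qed

lemma tri_0 [simp]: "tri 0 = 0" and tri_1 [simp]: "tri 1 = 0"
  by (simp_all add: tri_def)

lemma tri_Suc: "tri (int (Suc n)) = tri (int n) + int n"
  using tri_add[of "int n" 1] by (simp add: add.commute)

text \<open>Fubini: the iterated sums of norms converge, so the double family is absolutely
  summable, and the iterated sum gives its value. Absolute summability is part of the conclusion so
  that the lemma can be applied to its own output.\<close>

lemma has_sum_times:
  fixes f :: "'b \<Rightarrow> 'a :: {real_normed_field, banach}" and g :: "'c \<Rightarrow> 'a"
  assumes f: "(\<lambda>x. norm (f x)) summable_on A" "(f has_sum a) A"
    and g: "(\<lambda>y. norm (g y)) summable_on B" "(g has_sum b) B"
  shows "(\<lambda>p. norm (case p of (x, y) \<Rightarrow> f x * g y)) summable_on A \<times> B"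
    and "((\<lambda>(x, y). f x * g y) has_sum a * b) (A \<times> B)"
proof -
  have "(\<lambda>x. norm (f x) * infsum (\<lambda>y. norm (g y)) B) summable_on A"
    by (intro summable_on_cmult_left f)
  hence "(\<lambda>x. norm (norm (f x) * infsum (\<lambda>y. norm (g y)) B)) summable_on A"
    by (rule iffD1[OF summable_on_iff_abs_summable_on_real])
  thus *: "(\<lambda>p. norm (case p of (x, y) \<Rightarrow> f x * g y)) summable_on A \<times> B"
    by (subst Infinite_Sum.abs_summable_on_Sigma_iff)
       (auto simp: norm_mult infsum_cmult_right' intro!: summable_on_cmult_right g)
  hence "(\<lambda>(x, y). f x * g y) summable_on A \<times> B"
    by (rule abs_summable_summable)
  then obtain S where S: "((\<lambda>(x, y). f x * g y) has_sum S) (A \<times> B)"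
    by (auto simp: summable_on_def)
  have "((\<lambda>x. f x * b) has_sum S) A"
    by (rule has_sum_SigmaD[OF S]) (simp add: has_sum_cmult_right g)
  moreover have "((\<lambda>x. f x * b) has_sum a * b) A"
    by (intro has_sum_cmult_left f)
  ultimately show "((\<lambda>(x, y). f x * g y) has_sum a * b) (A \<times> B)"
    using S has_sum_unique by blast
qed

text \<open>Once n >= (b + 1) / e, the exponent is at most -n, so a geometric series
  dominates.\<close>

lemma summable_gaussian:
  fixes b e :: real
  assumes "e > 0"
  shows "summable (\<lambda>n. exp (b * real n - e * real n ^ 2))"
proof (rule summable_comparison_test_ev)
  show "summable (\<lambda>n. exp (-1) ^ n :: real)"
    by (intro summable_geometric) simp
  have "\<forall>\<^sub>F n in sequentially. real n \<ge> (b + 1) / e"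
    using eventually_ge_at_top[of "nat \<lceil>(b + 1) / e\<rceil>"]
    by eventually_elim linarith
  thus "\<forall>\<^sub>F n in sequentially. norm (exp (b * real n - e * real n ^ 2)) \<le> exp (-1) ^ n"
  proof eventually_elim
    case (elim n)
    hence "b + 1 \<le> e * real n"
      using assms by (simp add: field_simps)
    hence "(b + 1) * real n \<le> e * real n * real n"
      by (intro mult_right_mono) auto
    thus ?case
      by (simp add: exp_of_nat_mult [symmetric] power2_eq_square algebra_simps)
  qed
qed

lemma summable_on_gaussian_nat:
  fixes b e :: real
  assumes "e > 0"
  shows "(\<lambda>n::nat. exp (b * real n - e * real n ^ 2)) summable_on UNIV"
  using summable_gaussian[OF assms] by (subst summable_on_UNIV_nonneg_real_iff) auto

text \<open>Each half-line is a copy of the natural numbers, the negative one with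
  \<open>- b\<close> for \<open>b\<close>; the common point 0 does no harm to summability.\<close>

lemma summable_on_gaussian_int:
  fixes b e :: real
  assumes "e > 0"
  shows "(\<lambda>n::int. exp (b * of_int n - e * of_int n ^ 2)) summable_on UNIV"
proof -
  have "bij_betw int UNIV {0..}"
    by (rule bij_betwI[of _ _ _ nat]) auto
  hence 1: "(\<lambda>n::int. exp (b * of_int n - e * of_int n ^ 2)) summable_on {0..}"
    using summable_on_reindex_bij_betw[of int UNIV "{0..}" "\<lambda>n. exp (b * of_int n - e * of_int n ^ 2)"]
      summable_on_gaussian_nat[OF assms, of b] by simp
  have "bij_betw (\<lambda>n. - int n) UNIV {..0}"
    by (rule bij_betwI[of _ _ _ "\<lambda>n. nat (- n)"]) auto
  hence 2: "(\<lambda>n::int. exp (b * of_int n - e * of_int n ^ 2)) summable_on {..0}"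
    using summable_on_reindex_bij_betw[of "\<lambda>n. - int n" UNIV "{..0}" "\<lambda>n. exp (b * of_int n - e * of_int n ^ 2)"]
      summable_on_gaussian_nat[OF assms, of "- b"] by simp
  have "{..0} \<union> {0..} = (UNIV :: int set)"
    by auto
  thus ?thesis
    using summable_on_union[OF 2 1] by simp
qed

text \<open>Euler's coefficient (-1)^k r^(k(k-1)/2) / (r;r)_k of c^k in (c;r)_inf, see
  \<open>euler_coeff_eq\<close>. The product form exhibits the ratio of consecutive coefficients, on
  which the recursion and the norm bound rest.\<close>

definition euler_coeff :: "complex \<Rightarrow> nat \<Rightarrow> complex" where
  "euler_coeff r k = (\<Prod>j<k. - (r ^ j) / (1 - r ^ Suc j))"

lemma euler_coeff_0 [simp]: "euler_coeff r 0 = 1"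
  by (simp add: euler_coeff_def)

lemma one_minus_power_nonzero:
  fixes r :: complex
  assumes "norm r < 1" "k > 0"
  shows "1 - r ^ k \<noteq> 0"
proof
  assume "1 - r ^ k = 0"
  hence "norm r ^ k = 1"
    by (metis eq_iff_diff_eq_0 norm_one norm_power)
  moreover have "norm r ^ k < 1"
    using assms by (simp add: power_less_one_iff)
  ultimately show False by simp
qed

text \<open>This is what comparing coefficients in g(c) = (1 - c) g(c r) demands.\<close>

lemma euler_coeff_Suc:
  assumes "norm r < 1"
  shows "euler_coeff r (Suc k) * (1 - r ^ Suc k) = - (r ^ k * euler_coeff r k)"
  using one_minus_power_nonzero[OF assms, of "Suc k"]
  by (simp add: euler_coeff_def)

lemma euler_coeff_eq:
  assumes "r \<noteq> 0"
  shows "euler_coeff r k = (-1) ^ k * r powi tri (int k) / (\<Prod>j<k. 1 - r ^ Suc j)"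
proof (induction k)
  case (Suc k)
  have "euler_coeff r (Suc k) = euler_coeff r k * (- (r ^ k) / (1 - r ^ Suc k))"
    by (simp add: euler_coeff_def)
  thus ?case
    unfolding Suc.IH tri_Suc using assms by (simp add: power_int_add)
qed simp

text \<open>Passing from k to k + 1 costs a factor of at most C |r|^k, which accumulates to C^k
  |r|^(k(k-1)/2): a Gaussian of rate -ln |r| / 2 whose linear part goes into
  \<open>b\<close>.\<close>

lemma norm_euler_coeff_le:
  assumes "0 < norm r" "norm r < 1"
  shows "\<exists>b. \<forall>k. norm (euler_coeff r k * c ^ k) \<le> exp (b * real k - (- ln (norm r) / 2) * real k ^ 2)"
proof -
  \<comment> \<open>The summand 1 keeps \<open>C\<close> positive for \<open>c = 0\<close>, so that
    \<open>ln C\<close> can be used.\<close>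
  define C where "C = (norm c + 1) / (1 - norm r)"
  have C: "C > 0"
    using assms by (auto simp: C_def intro!: divide_pos_pos add_nonneg_pos)
  have "norm (euler_coeff r k * c ^ k) \<le> exp (ln C * real k + ln (norm r) * of_int (tri (int k)))" for k
  proof (induction k)
    case (Suc k)
    have "euler_coeff r (Suc k) * c ^ Suc k = (euler_coeff r k * c ^ k) * (- (r ^ k) * (c / (1 - r ^ Suc k)))"
      by (simp add: euler_coeff_def)
    hence "norm (euler_coeff r (Suc k) * c ^ Suc k) =
        norm (euler_coeff r k * c ^ k) * (norm r ^ k * (norm c / norm (1 - r ^ Suc k)))"
      by (simp add: norm_mult norm_divide norm_power)
    also have "\<dots> \<le> exp (ln C * real k + ln (norm r) * of_int (tri (int k))) * (norm r ^ k * C)"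
    proof (intro mult_mono Suc.IH order_refl)
      have "norm r ^ Suc k \<le> norm r"
        using assms power_Suc_le_self[of "norm r" k] by simp
      hence "norm (r ^ Suc k) \<le> norm r"
        unfolding norm_power .
      moreover have "1 - norm (r ^ Suc k) \<le> norm (1 - r ^ Suc k)"
        by (metis norm_one norm_triangle_ineq2)
      ultimately have "1 - norm r \<le> norm (1 - r ^ Suc k)"
        by linarith
      thus "norm c / norm (1 - r ^ Suc k) \<le> C"
        unfolding C_def using assms by (intro frac_le) auto
    qed (use C in auto)
    also have "norm r ^ k * C = exp (ln (norm r) * real k + ln C)"
      using assms C by (simp add: exp_of_nat2_mult exp_add)
    finally show ?case
      unfolding tri_Suc by (simp add: exp_add [symmetric] algebra_simps)
  qed simp
  hence "norm (euler_coeff r k * c ^ k) \<le>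
      exp ((ln C - ln (norm r) / 2) * real k - (- ln (norm r) / 2) * real k ^ 2)" for k
    by (rule order_trans) (simp add: of_int_tri field_simps)
  thus ?thesis by blast
qed

lemma summable_euler:
  assumes "0 < norm r" "norm r < 1"
  shows "(\<lambda>k. norm (euler_coeff r k * c ^ k)) summable_on UNIV"
proof -
  obtain b where b: "norm (euler_coeff r k * c ^ k) \<le> exp (b * real k - (- ln (norm r) / 2) * real k ^ 2)" for k
    using norm_euler_coeff_le[OF assms] by blast
  have "- ln (norm r) / 2 > 0"
    using assms by (simp add: ln_less_zero)
  from summable_on_gaussian_nat[OF this] show ?thesis
    by (rule Infinite_Sum.abs_summable_on_comparison_test') (use b in blast)
qed

section \<open>Convergence, zeros and functional equation of the q-shifted factorial\<close>

lemma qpoch_convergent: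
  fixes c r :: complex
  assumes "norm r < 1"
  shows "convergent_prod (\<lambda>k. 1 - c * r ^ k)"
proof -
  have "summable (\<lambda>k. norm (c * r ^ k))"
    using assms by (simp add: norm_mult norm_power summable_mult summable_geometric)
  hence "summable (\<lambda>k. norm ((1 - c * r ^ k) - 1))"
    by simp
  thus ?thesis
    by (intro abs_convergent_prod_imp_convergent_prod)
       (simp add: abs_convergent_prod_conv_summable)
qed

lemma qpoch_tendsto:
  assumes "norm r < 1"
  shows "(\<lambda>n. \<Prod>k<n. 1 - c * r ^ k) \<longlonglongrightarrow> qpoch c r"
  using convergent_prod_LIMSEQ[OF qpoch_convergent[OF assms, of c]]
  by (simp add: qpoch_def lessThan_Suc_atMost [symmetric] LIMSEQ_lessThan_iff_atMost)

lemma qpoch_eq_0_iff: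
  assumes "norm r < 1"
  shows "qpoch c r = 0 \<longleftrightarrow> (\<exists>k. c * r ^ k = 1)"
  using has_prod_eq_0_iff[OF convergent_prod_has_prod[OF qpoch_convergent[OF assms, of c]]]
  by (auto simp: qpoch_def image_iff)

lemma qpoch_step:
  assumes "norm r < 1"
  shows "qpoch c r = (1 - c) * qpoch (c * r) r"
proof -
  have "(\<lambda>n. \<Prod>k<Suc n. 1 - c * r ^ k) \<longlonglongrightarrow> qpoch c r"
    using qpoch_tendsto[OF assms] by (rule LIMSEQ_Suc)
  moreover have "(\<lambda>n. \<Prod>k<Suc n. 1 - c * r ^ k) = (\<lambda>n. (1 - c) * (\<Prod>k<n. 1 - c * r * r ^ k))"
    by (subst prod.lessThan_Suc_shift) (simp add: mult.assoc)
  moreover have "(\<lambda>n. (1 - c) * (\<Prod>k<n. 1 - c * r * r ^ k)) \<longlonglongrightarrow> (1 - c) * qpoch (c * r) r"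
    by (intro tendsto_mult_left qpoch_tendsto assms)
  ultimately show ?thesis
    using LIMSEQ_unique by metis
qed

lemma qpoch_split:
  assumes "norm r < 1"
  shows "qpoch c r = (\<Prod>k<n. 1 - c * r ^ k) * qpoch (c * r ^ n) r"
proof (induction n)
  case (Suc n)
  show ?case
    using qpoch_step[OF assms, of "c * r ^ n"] by (subst Suc.IH) (simp add: mult_ac)
qed simp

text \<open>A power series is continuous at 0. This closes the iteration of a functional equation
  linking c and c r, both for Euler's entire series and for the reciprocal series with finite
  radius.\<close>

lemma powser_geometric_tendsto:
  fixes c r :: complex
  assumes r: "norm r < 1" and c: "norm c < R"
    and g: "\<And>c. norm c < R \<Longrightarrow> (\<lambda>k. a k * c ^ k) sums g c"
  shows "(\<lambda>n. g (c * r ^ n)) \<longlonglongrightarrow> a 0"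
proof -
  have R: "R > 0"
    using c norm_ge_zero[of c] by linarith
  have "(g \<longlongrightarrow> a 0) (at 0)"
    by (rule powser_limit_0[OF R]) (use g in simp)
  hence "isCont g 0"
    using g[of 0] R by (simp add: isCont_def sums_iff powser_zero)
  moreover have "(\<lambda>n. c * r ^ n) \<longlonglongrightarrow> 0"
    using r by (intro tendsto_mult_right_zero LIMSEQ_power_zero)
  ultimately have "(\<lambda>n. g (c * r ^ n)) \<longlonglongrightarrow> g 0"
    by (rule isCont_tendsto_compose)
  thus ?thesis
    using g[of 0] R by (simp add: sums_iff powser_zero)
qed

lemma norm_mult_power_less:
  fixes c r :: complex
  assumes "norm r < 1" "norm c < R"
  shows "norm (c * r ^ n) < R"
proof -
  have "norm c * norm r ^ n \<le> norm c * 1"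
    using assms by (intro mult_left_mono power_le_one) auto
  thus ?thesis using assms by (simp add: norm_mult norm_power)
qed

text \<open>The series g satisfies g(c) = (1 - c) g(c r). Iterating n times splits off the n-th
  partial product of (c;r)_inf, and the remaining factor g(c r^n) tends to 1.\<close>

lemma euler_sums:
  assumes "0 < norm r" "norm r < 1"
  shows "(\<lambda>k. euler_coeff r k * c ^ k) sums qpoch c r"
proof -
  define g where "g c = (\<Sum>k. euler_coeff r k * c ^ k)" for c
  have g: "(\<lambda>k. euler_coeff r k * c ^ k) sums g c" for c
    unfolding g_def using abs_summable_summable[OF summable_euler[OF assms]]
    by (intro summable_sums summable_on_imp_summable)
  have step: "g c = (1 - c) * g (c * r)" for c
  proof -
    have *: "(\<lambda>k. euler_coeff r k * c ^ k - euler_coeff r k * (c * r) ^ k) sums (g c - g (c * r))"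
      by (intro sums_diff g)
    \<comment> \<open>At index 0 the two terms cancel, so the series of differences has the same sum
      as its shift by one.\<close>
    have "(\<lambda>k. euler_coeff r (Suc k) * c ^ Suc k - euler_coeff r (Suc k) * (c * r) ^ Suc k)
        = (\<lambda>k. - c * (euler_coeff r k * (c * r) ^ k))"
    proof
      fix k
      have "euler_coeff r (Suc k) * c ^ Suc k - euler_coeff r (Suc k) * (c * r) ^ Suc k =
        c ^ Suc k * (euler_coeff r (Suc k) * (1 - r ^ Suc k))"
        by (simp add: algebra_simps power_mult_distrib)
      also have "\<dots> = - c * (euler_coeff r k * (c * r) ^ k)"
        unfolding euler_coeff_Suc[OF assms(2)] by (simp add: algebra_simps power_mult_distrib)
      finally show "euler_coeff r (Suc k) * c ^ Suc k - euler_coeff r (Suc k) * (c * r) ^ Suc k =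
        - c * (euler_coeff r k * (c * r) ^ k)" .
    qed
    moreover have "(\<lambda>k. - c * (euler_coeff r k * (c * r) ^ k)) sums (- c * g (c * r))"
      by (intro sums_mult g)
    ultimately have "(\<lambda>k. euler_coeff r k * c ^ k - euler_coeff r k * (c * r) ^ k) sums (- c * g (c * r))"
      using sums_Suc_iff[of "\<lambda>k. euler_coeff r k * c ^ k - euler_coeff r k * (c * r) ^ k"] by simp
    with * have "g c - g (c * r) = - c * g (c * r)"
      by (rule sums_unique2)
    thus ?thesis by (simp add: algebra_simps)
  qed
  have iter: "g c = (\<Prod>k<n. 1 - c * r ^ k) * g (c * r ^ n)" for n
  proof (induction n)
    case (Suc n)
    show ?case
      using step[of "c * r ^ n"] by (subst Suc.IH) (simp add: mult_ac)
  qed simp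
  have "(\<lambda>n. g (c * r ^ n)) \<longlonglongrightarrow> euler_coeff r 0"
    by (rule powser_geometric_tendsto[of r c "norm c + 1"]) (use assms g in auto)
  hence "(\<lambda>n. (\<Prod>k<n. 1 - c * r ^ k) * g (c * r ^ n)) \<longlonglongrightarrow> qpoch c r * 1"
    by (intro tendsto_mult qpoch_tendsto assms) simp
  hence "g c = qpoch c r"
    unfolding iter [symmetric] by (simp add: LIMSEQ_const_iff)
  thus ?thesis using g[of c] by simp
qed

lemma euler_has_sum:
  assumes "0 < norm r" "norm r < 1"
  shows "((\<lambda>k. euler_coeff r k * c ^ k) has_sum qpoch c r) UNIV"
  by (rule norm_summable_imp_has_sum[OF summable_on_imp_summable[OF summable_euler[OF assms]] euler_sums[OF assms]])

text \<open>By Euler's expansion, (c;r)_inf is an everywhere convergent power series in c.\<close>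

lemma continuous_qpoch [continuous_intros]:
  assumes "0 < norm r" "norm r < 1" "continuous_on A h"
  shows "continuous_on A (\<lambda>x. qpoch (h x) r)"
proof -
  have "isCont (\<lambda>c. qpoch c r) c" for c
  proof -
    have "isCont (\<lambda>c. \<Sum>k. euler_coeff r k * c ^ k) c"
      by (rule isCont_powser_converges_everywhere) (rule sums_summable[OF euler_sums[OF assms(1,2)]])
    moreover have "(\<lambda>c. \<Sum>k. euler_coeff r k * c ^ k) = (\<lambda>c. qpoch c r)"
      by (rule ext) (rule sums_unique[OF euler_sums[OF assms(1,2)], symmetric])
    ultimately show ?thesis by simp
  qed
  hence "continuous_on UNIV (\<lambda>c. qpoch c r)"
    by (simp add: continuous_at_imp_continuous_on)
  thus ?thesis
    using assms(3) by (rule continuous_on_compose2) auto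
qed

section \<open>Theta series and the Jacobi triple product\<close>

lemma real_powi_eq_exp:
  fixes x :: real
  assumes "x > 0"
  shows "x powi n = exp (ln x * of_int n)"
  using assms by (cases n rule: int_cases4) (auto simp: exp_of_nat2_mult power_int_minus exp_minus)

definition theta_term :: "complex \<Rightarrow> complex \<Rightarrow> int \<Rightarrow> complex" where
  "theta_term q w n = q powi tri n * w powi n"

definition theta_series :: "complex \<Rightarrow> complex \<Rightarrow> complex" where
  "theta_series q w = (\<Sum>\<^sub>\<infinity>n. theta_term q w n)"

text \<open>Summed over \<open>m\<close>, this becomes the quasi-periodicity of the theta
  series.\<close>

lemma theta_term_add:
  assumes "q \<noteq> 0" "w \<noteq> 0"
  shows "theta_term q w (m + n) = theta_term q w n * theta_term q (w * q powi n) m"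
  using assms
  by (simp add: theta_term_def tri_add power_int_add power_int_mult_distrib power_int_mult [symmetric] mult_ac)

text \<open>The norm is exactly a Gaussian in n, of rate -ln |q| / 2.\<close>

lemma summable_theta_term:
  assumes "0 < norm q" "norm q < 1" "w \<noteq> 0"
  shows "(\<lambda>n. norm (theta_term q w n)) summable_on UNIV"
proof -
  have "norm (theta_term q w n) =
      exp ((ln (norm w) - ln (norm q) / 2) * of_int n - (- ln (norm q) / 2) * of_int n ^ 2)" for n
    using assms
    by (simp add: theta_term_def norm_mult norm_power_int real_powi_eq_exp exp_add [symmetric] of_int_tri field_simps)
  moreover have "- ln (norm q) / 2 > 0"
    using assms by (simp add: ln_less_zero)
  ultimately show ?thesis
    by (simp only: summable_on_gaussian_int)
qed

lemma theta_series_has_sum: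
  assumes "0 < norm q" "norm q < 1" "w \<noteq> 0"
  shows "(theta_term q w has_sum theta_series q w) UNIV"
  unfolding theta_series_def
  by (rule has_sum_infsum[OF abs_summable_summable[OF summable_theta_term[OF assms]]])

lemma theta_series_shift:
  assumes "0 < norm q" "norm q < 1" "w \<noteq> 0"
  shows "theta_series q w = theta_term q w n * theta_series q (w * q powi n)"
proof -
  have "bij_betw (\<lambda>m. m + n) UNIV UNIV"
    by (rule bij_betwI[of _ _ _ "\<lambda>m. m - n"]) auto
  hence "((\<lambda>m. theta_term q w (m + n)) has_sum theta_series q w) UNIV"
    using theta_series_has_sum[OF assms] by (subst has_sum_reindex_bij_betw)
  moreover have "((\<lambda>m. theta_term q w (m + n)) has_sum theta_term q w n * theta_series q (w * q powi n)) UNIV"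
    unfolding theta_term_add[OF assms(1)[unfolded zero_less_norm_iff] assms(3)]
    using assms by (intro has_sum_cmult_right theta_series_has_sum) auto
  ultimately show ?thesis
    by (rule has_sum_unique)
qed

text \<open>
  Both sides are the sum of one absolutely convergent double series: with \<open>m = n + d i\<close>,
  completing the square in the exponent of \<open>q\<close> separates the variables \<open>m\<close> and \<open>i\<close>.
\<close>

lemma laurent_theta_has_sum:
  fixes c :: "'i \<Rightarrow> complex" and d :: "'i \<Rightarrow> int" and q z :: complex
  defines "K \<equiv> \<lambda>i. c i * q powi (- tri (d i)) * z powi (- d i)"
  assumes q: "0 < norm q" "norm q < 1" and "z \<noteq> 0" "u \<noteq> 0"
    and K: "(\<lambda>i. norm (K i)) summable_on UNIV"
    and N: "\<And>v. v \<noteq> 0 \<Longrightarrow> ((\<lambda>i. c i * v powi d i) has_sum N v) UNIV"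
  shows "((\<lambda>n. N (u * q powi n) * theta_term q (z * u) n) has_sum
           theta_series q (z * u) * infsum K UNIV) UNIV" (is "(?h has_sum ?S) _")
    and "(\<lambda>n. norm (N (u * q powi n) * theta_term q (z * u) n)) summable_on UNIV"
    and "(\<Sum>\<^sub>\<infinity>n. norm (N (u * q powi n) * theta_term q (z * u) n)) \<le>
           (\<Sum>\<^sub>\<infinity>n. norm (theta_term q (z * u) n)) * (\<Sum>\<^sub>\<infinity>i. norm (K i))"
proof -
  have q0: "q \<noteq> 0" and zu: "z * u \<noteq> 0"
    using assms by auto
  define g where "g = (\<lambda>(n, i). theta_term q (z * u) n * (c i * (u * q powi n) powi d i))"
  have g_eq: "g p = (case (fst p + d (snd p), snd p) of (m, i) \<Rightarrow> theta_term q (z * u) m * K i)" for p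
    using q0 assms(4,5)
    by (simp add: g_def K_def theta_term_def case_prod_beta tri_add power_int_add power_int_mult_distrib
        power_int_mult [symmetric] power_int_minus divide_simps)
  have bij: "bij_betw (\<lambda>p. (fst p + d (snd p), snd p)) (UNIV \<times> UNIV) (UNIV \<times> UNIV)"
    by (rule bij_betwI[of _ _ _ "\<lambda>p. (fst p - d (snd p), snd p)"]) auto
  \<comment> \<open>Leaving \<open>F\<close> arbitrary lets the same change of variables serve the
    series itself and the series of norms.\<close>
  have reindex: "((\<lambda>p. F (case (fst p + d (snd p), snd p) of (m, i) \<Rightarrow> theta_term q (z * u) m * K i)) has_sum s)
        (UNIV \<times> UNIV) \<longleftrightarrow>
      ((\<lambda>p. F (case p of (m, i) \<Rightarrow> theta_term q (z * u) m * K i)) has_sum s) (UNIV \<times> UNIV)"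
    for F :: "complex \<Rightarrow> 'b::{comm_monoid_add, topological_space}" and s
    by (rule has_sum_reindex_bij_betw[OF bij, of "\<lambda>p. F (case p of (m, i) \<Rightarrow> theta_term q (z * u) m * K i)"])
  have Ks: "(K has_sum infsum K UNIV) UNIV"
    by (rule has_sum_infsum[OF abs_summable_summable[OF K]])
  have "((\<lambda>(m, i). theta_term q (z * u) m * K i) has_sum ?S) (UNIV \<times> UNIV)"
    by (intro has_sum_times summable_theta_term theta_series_has_sum q zu K Ks)
  hence g1: "(g has_sum ?S) (UNIV \<times> UNIV)"
    using reindex[of "\<lambda>x. x" ?S] by (simp add: g_eq [abs_def])
  \<comment> \<open>The norms factor in the same way; this yields a bound that depends on
    \<open>u\<close> only through the theta terms.\<close>
  have "((\<lambda>(m, i). norm (theta_term q (z * u) m) * norm (K i)) has_sum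
          (\<Sum>\<^sub>\<infinity>n. norm (theta_term q (z * u) n)) * (\<Sum>\<^sub>\<infinity>i. norm (K i))) (UNIV \<times> UNIV)"
    using summable_theta_term[OF q zu] K by (intro has_sum_times) auto
  hence g2: "((\<lambda>p. norm (g p)) has_sum
      (\<Sum>\<^sub>\<infinity>n. norm (theta_term q (z * u) n)) * (\<Sum>\<^sub>\<infinity>i. norm (K i))) (UNIV \<times> UNIV)"
    using reindex[of norm] by (simp add: g_eq [abs_def] case_prod_unfold norm_mult)
  \<comment> \<open>Summing over \<open>i\<close> first, in the original variables, restores the
    values of \<open>N\<close>.\<close>
  have inner: "((\<lambda>i. g (n, i)) has_sum ?h n) UNIV" for n
  proof -
    have "((\<lambda>i. theta_term q (z * u) n * (c i * (u * q powi n) powi d i)) has_sum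
        theta_term q (z * u) n * N (u * q powi n)) UNIV"
      using q0 \<open>u \<noteq> 0\<close> by (intro has_sum_cmult_right N) auto
    thus ?thesis by (simp add: g_def mult.commute)
  qed
  show "(?h has_sum ?S) UNIV"
    by (rule has_sum_SigmaD[OF g1]) (rule inner)
  have "(\<lambda>p. norm (g p)) summable_on UNIV \<times> UNIV"
    using g2 by (auto simp: summable_on_def)
  hence inner_abs: "(\<lambda>i. norm (g (n, i))) summable_on UNIV" for n
    using summable_on_SigmaD1[of "\<lambda>n i. norm (g (n, i))" UNIV "\<lambda>_. UNIV" n] by (simp add: case_prod_unfold)
  have outer: "((\<lambda>n. \<Sum>\<^sub>\<infinity>i. norm (g (n, i))) has_sum
      (\<Sum>\<^sub>\<infinity>n. norm (theta_term q (z * u) n)) * (\<Sum>\<^sub>\<infinity>i. norm (K i))) UNIV"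
    by (rule has_sum_SigmaD[OF g2]) (intro has_sum_infsum inner_abs)
  have le: "norm (?h n) \<le> (\<Sum>\<^sub>\<infinity>i. norm (g (n, i)))" for n
    using norm_infsum_bound[OF inner_abs[of n]] infsumI[OF inner[of n]] by simp
  have outer': "(\<lambda>n. \<Sum>\<^sub>\<infinity>i. norm (g (n, i))) summable_on UNIV"
    using outer by (auto simp: summable_on_def)
  thus *: "(\<lambda>n. norm (?h n)) summable_on UNIV"
    by (rule Infinite_Sum.abs_summable_on_comparison_test') (rule le)
  show "(\<Sum>\<^sub>\<infinity>n. norm (?h n)) \<le>
           (\<Sum>\<^sub>\<infinity>n. norm (theta_term q (z * u) n)) * (\<Sum>\<^sub>\<infinity>i. norm (K i))"
    unfolding infsumI[OF outer, symmetric] by (intro infsum_mono * outer' le)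
qed

section \<open>The product form of theta and the Jacobi triple product\<close>

definition theta_prod :: "complex \<Rightarrow> complex \<Rightarrow> complex" where
  "theta_prod q w = qpoch (- w) q * qpoch (- q / w) q"

text \<open>Replacing w by w q removes the factor 1 + w from the first product and adds 1 + 1/w to
  the second; their quotient is w.\<close>

lemma theta_prod_shift:
  assumes "0 < norm q" "norm q < 1" "w \<noteq> 0"
  shows "theta_prod q w = w * theta_prod q (w * q)"
proof -
  have 1: "qpoch (- w) q = (1 + w) * qpoch (- (w * q)) q"
    using qpoch_step[OF assms(2), of "- w"] by simp
  have 2: "qpoch (- q / (w * q)) q = (1 + 1 / w) * qpoch (- q / w) q"
    using qpoch_step[OF assms(2), of "- 1 / w"] assms by simp
  have 3: "1 + w = w * (1 + 1 / w)"
    using assms by (simp add: field_simps)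
  show ?thesis
    unfolding theta_prod_def 1 2 unfolding 3 by (simp only: mult_ac)
qed

text \<open>Euler's second expansion, of 1 / (v;q)_inf, again from a functional equation: (1 - x)
  h(x) = h(x q). The small disc comes from the crude estimate |1 - q^(j+1)| >= 1 - |q|;
  quasi-periodicity later makes up for it.\<close>

lemma recip_euler_sums:
  assumes q: "norm q < 1" and v: "norm v < 1 - norm q"
  shows "summable (\<lambda>m. norm (v ^ m / (\<Prod>j<m. 1 - q ^ Suc j)))"
    and "(\<Sum>m. v ^ m / (\<Prod>j<m. 1 - q ^ Suc j)) * qpoch v q = 1"
proof -
  define b where "b m = 1 / (\<Prod>j<m. 1 - q ^ Suc j)" for m
  have b_Suc: "b (Suc m) * (1 - q ^ Suc m) = b m" for m
    using one_minus_power_nonzero[OF q, of "Suc m"] by (simp add: b_def)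
  have norm_b: "norm (b m) \<le> (1 / (1 - norm q)) ^ m" for m
  proof (induction m)
    case (Suc m)
    have "norm q ^ Suc m \<le> norm q"
      using q power_Suc_le_self[of "norm q" m] by simp
    hence "norm (q ^ Suc m) \<le> norm q"
      unfolding norm_power .
    moreover have "1 - norm (q ^ Suc m) \<le> norm (1 - q ^ Suc m)"
      by (metis norm_one norm_triangle_ineq2)
    ultimately have "1 - norm q \<le> norm (1 - q ^ Suc m)"
      by linarith
    hence "1 / norm (1 - q ^ Suc m) \<le> 1 / (1 - norm q)"
      using q by (intro frac_le) auto
    hence "norm (b m) * (1 / norm (1 - q ^ Suc m)) \<le> (1 / (1 - norm q)) ^ m * (1 / (1 - norm q))"
      using q by (intro mult_mono Suc.IH) auto
    thus ?case
      by (simp add: b_def norm_mult norm_divide)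
  qed (simp add: b_def)
  define R where "R = 1 - norm q"
  have b_sum: "summable (\<lambda>m. norm (b m * x ^ m))" if x: "norm x < R" for x
  proof (rule summable_comparison_test)
    show "summable (\<lambda>m. (norm x / (1 - norm q)) ^ m)"
      using x q by (intro summable_geometric) (simp add: R_def)
    have "norm (b m * x ^ m) \<le> (norm x / (1 - norm q)) ^ m" for m
      using mult_right_mono[OF norm_b[of m], of "norm x ^ m"]
      by (simp add: norm_mult norm_power power_divide)
    thus "\<exists>N. \<forall>m\<ge>N. norm (norm (b m * x ^ m)) \<le> (norm x / (1 - norm q)) ^ m"
      by simp
  qed
  have v': "norm v < R"
    using v by (simp add: R_def)
  show "summable (\<lambda>m. norm (v ^ m / (\<Prod>j<m. 1 - q ^ Suc j)))"
    using b_sum[OF v'] by (simp add: b_def norm_divide)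
  define h where "h x = (\<Sum>m. b m * x ^ m)" for x
  have h: "(\<lambda>m. b m * x ^ m) sums h x" if "norm x < R" for x
    unfolding h_def by (rule summable_sums[OF summable_norm_cancel[OF b_sum[OF that]]])
  have step: "(1 - x) * h x = h (x * q)" if x: "norm x < R" for x
  proof -
    have xq: "norm (x * q) < R"
      using norm_mult_power_less[OF q x, of 1] by simp
    have *: "(\<lambda>m. b m * x ^ m - b m * (x * q) ^ m) sums (h x - h (x * q))"
      by (intro sums_diff h x xq)
    have "b (Suc m) * x ^ Suc m - b (Suc m) * (x * q) ^ Suc m = x * (b m * x ^ m)" for m
    proof -
      have "b (Suc m) * x ^ Suc m - b (Suc m) * (x * q) ^ Suc m = x ^ Suc m * (b (Suc m) * (1 - q ^ Suc m))"
        by (simp add: algebra_simps power_mult_distrib)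
      thus ?thesis
        unfolding b_Suc by simp
    qed
    hence "(\<lambda>m. b m * x ^ m - b m * (x * q) ^ m) sums (x * h x)"
      using sums_Suc_iff[of "\<lambda>m. b m * x ^ m - b m * (x * q) ^ m"] sums_mult[OF h[OF x], of x] by simp
    with * have "h x - h (x * q) = x * h x"
      by (rule sums_unique2)
    thus ?thesis by (simp add: algebra_simps)
  qed
  have iter: "(\<Prod>k<n. 1 - v * q ^ k) * h v = h (v * q ^ n)" for n
  proof (induction n)
    case (Suc n)
    have "(\<Prod>k<Suc n. 1 - v * q ^ k) * h v = (1 - v * q ^ n) * h (v * q ^ n)"
      unfolding Suc.IH [symmetric] by simp
    also have "\<dots> = h (v * q ^ n * q)"
      by (rule step[OF norm_mult_power_less[OF q v']])
    finally show ?case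
      by (simp add: mult_ac)
  qed simp
  have "(\<lambda>n. h (v * q ^ n)) \<longlonglongrightarrow> b 0"
    by (rule powser_geometric_tendsto[OF q v' h])
  moreover have "(\<lambda>n. (\<Prod>k<n. 1 - v * q ^ k) * h v) \<longlonglongrightarrow> qpoch v q * h v"
    by (intro tendsto_mult_right qpoch_tendsto q)
  ultimately have "qpoch v q * h v = b 0"
    unfolding iter using LIMSEQ_unique by blast
  thus "(\<Sum>m. v ^ m / (\<Prod>j<m. 1 - q ^ Suc j)) * qpoch v q = 1"
    by (simp add: h_def b_def mult.commute)
qed

text \<open>The double series lemma is applied to N(x) = (q x; q)_inf with u = 1. One side is the
  theta series times the expansion of 1 / (-q/w; q)_inf, the other collapses to an Euler expansion
  at -w. The hypothesis on \<open>w\<close> puts -q/w into the disc of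
  \<open>recip_euler_sums\<close>.\<close>

lemma jacobi_triple_product_aux:
  assumes q: "0 < norm q" "norm q < 1" and w: "norm q < norm w * (1 - norm q)"
  shows "theta_series q w = qpoch q q * theta_prod q w"
proof -
  have q0: "q \<noteq> 0" and w0: "w \<noteq> 0"
    using assms by auto
  define a where "a m = (- q / w) ^ m / (\<Prod>j<m. 1 - q ^ Suc j)" for m
  have v: "norm (- q / w) < 1 - norm q"
    using w w0 by (simp add: norm_divide field_simps)
  have K: "euler_coeff q k * q ^ k * q powi (- tri (int k)) * w powi (- int k) = a k" for k
    using q0 w0 by (simp add: euler_coeff_eq a_def power_int_minus field_simps power_divide power_minus')
  have a: "(\<lambda>m. norm (a m)) summable_on UNIV"
    using recip_euler_sums(1)[OF q(2) v]
    by (subst summable_on_UNIV_nonneg_real_iff) (auto simp: a_def)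
  have N: "((\<lambda>k. euler_coeff q k * q ^ k * x powi int k) has_sum qpoch (q * x) q) UNIV" for x
    using euler_has_sum[OF q, of "q * x"] by (simp add: power_mult_distrib mult_ac)
  have 1: "((\<lambda>n. qpoch (q * q powi n) q * theta_term q w n) has_sum theta_series q w * infsum a UNIV) UNIV"
    using laurent_theta_has_sum(1)[OF q w0 one_neq_zero, where c = "\<lambda>k. euler_coeff q k * q ^ k" and d = int
        and N = "\<lambda>x. qpoch (q * x) q", unfolded K mult_1_left mult_1_right, OF a N] .
  \<comment> \<open>For negative n the factor of index -n - 1 is 1 - q^0 = 0.\<close>
  have neg: "qpoch (q * q powi n) q = 0" if "n < 0" for n
  proof -
    have "q * q powi n * q ^ nat (- n - 1) = q powi (1 + n + int (nat (- n - 1)))"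
      using q0 by (simp only: power_int_add power_int_1_right power_int_of_nat simp_thms)
    also have "1 + n + int (nat (- n - 1)) = 0"
      using that by simp
    finally show ?thesis
      unfolding qpoch_eq_0_iff[OF q(2)] by auto
  qed
  \<comment> \<open>Splitting n factors off (q;q)_inf produces the denominator of
    \<open>euler_coeff q n\<close>.\<close>
  have pos: "qpoch (q * q powi int n) q * theta_term q w (int n) = qpoch q q * (euler_coeff q n * (- w) ^ n)" for n
  proof -
    have "(\<Prod>k<n. 1 - q ^ Suc k) \<noteq> 0"
      using one_minus_power_nonzero[OF q(2)] by (auto simp del: power_Suc)
    moreover have "qpoch q q = (\<Prod>k<n. 1 - q ^ Suc k) * qpoch (q * q ^ n) q"
      using qpoch_split[OF q(2), of q n] by simp
    ultimately show ?thesis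
      using q0 by (simp add: theta_term_def euler_coeff_eq power_minus' [of w])
  qed
  have "((\<lambda>n. qpoch q q * (euler_coeff q n * (- w) ^ n)) has_sum qpoch q q * qpoch (- w) q) UNIV"
    by (intro has_sum_cmult_right euler_has_sum q)
  moreover have "bij_betw int UNIV {0..}"
    by (rule bij_betwI[of _ _ _ nat]) auto
  ultimately have "((\<lambda>n. qpoch (q * q powi n) q * theta_term q w n) has_sum qpoch q q * qpoch (- w) q) {0..}"
    using has_sum_reindex_bij_betw[of int UNIV "{0..}" "\<lambda>n. qpoch (q * q powi n) q * theta_term q w n"]
    unfolding pos by blast
  hence "((\<lambda>n. qpoch (q * q powi n) q * theta_term q w n) has_sum qpoch q q * qpoch (- w) q) UNIV"
    by (rule has_sum_cong_neutral[THEN iffD1, rotated -1]) (auto simp: neg)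
  with 1 have "theta_series q w * infsum a UNIV = qpoch q q * qpoch (- w) q"
    by (rule has_sum_unique)
  moreover have "infsum a UNIV * qpoch (- q / w) q = 1"
  proof -
    have "infsum a UNIV = suminf a"
      by (rule sums_unique[OF has_sum_imp_sums[OF has_sum_infsum[OF abs_summable_summable[OF a]]]])
    thus ?thesis
      using recip_euler_sums(2)[OF q(2) v] by (simp add: a_def [abs_def])
  qed
  ultimately show ?thesis
    unfolding theta_prod_def by (metis mult.assoc mult.right_neutral)
qed

text \<open>Both sides satisfy F(x) = x F(x q). For large n the point w / q^n is covered by the
  auxiliary lemma, and n shifts carry the identity from there to w.\<close>

lemma jacobi_triple_product:
  assumes q: "0 < norm q" "norm q < 1" and "w \<noteq> 0"
  shows "theta_series q w = qpoch q q * theta_prod q w"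
proof -
  have q0: "q \<noteq> 0"
    using q by auto
  have "theta_series q (w / q ^ n * q ^ n) = qpoch q q * theta_prod q (w / q ^ n * q ^ n)"
    if large: "norm q < norm (w / q ^ n) * (1 - norm q)" for n
  proof -
    have "theta_series q (w / q ^ n * q ^ m) = qpoch q q * theta_prod q (w / q ^ n * q ^ m)" for m
    proof (induction m)
      case 0
      thus ?case using jacobi_triple_product_aux[OF q large] by simp
    next
      case (Suc m)
      define x where "x = w / q ^ n * q ^ m"
      have x: "x \<noteq> 0"
        using q0 \<open>w \<noteq> 0\<close> by (simp add: x_def)
      have "x * theta_series q (x * q) = theta_series q x"
        using theta_series_shift[OF q x, of 1] by (simp add: theta_term_def)
      also have "\<dots> = qpoch q q * theta_prod q x"
        unfolding x_def by (rule Suc.IH)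
      also have "\<dots> = x * (qpoch q q * theta_prod q (x * q))"
        unfolding theta_prod_shift[OF q x] by simp
      finally have "theta_series q (x * q) = qpoch q q * theta_prod q (x * q)"
        using x by simp
      moreover have "w / q ^ n * q ^ Suc m = x * q"
        by (simp add: x_def mult_ac)
      ultimately show ?case by simp
    qed
    thus ?thesis .
  qed
  moreover obtain n where "norm q < norm (w / q ^ n) * (1 - norm q)"
  proof -
    have "norm w * (1 - norm q) / norm q > 0"
      using q \<open>w \<noteq> 0\<close> by (intro divide_pos_pos mult_pos_pos) auto
    then obtain n where "norm q ^ n < norm w * (1 - norm q) / norm q"
      using real_arch_pow_inv q(2) by blast
    thus ?thesis
      using q q0 by (intro that[of n]) (simp add: norm_divide norm_power field_simps)
  qed
  ultimately show ?thesis using q0 by simp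
qed

section \<open>Periodization and the integral\<close>

text \<open>The line is cut into translates of [0, 1), and sum and integral are exchanged. The
  uniform bound \<open>B\<close> on the sums of norms provides the integrable majorant on the unit
  interval.\<close>

lemma integral_eq_periodization:
  fixes f :: "real \<Rightarrow> complex"
  assumes meas [measurable]: "f \<in> borel_measurable borel"
    and abs: "\<And>x. 0 \<le> x \<Longrightarrow> x < 1 \<Longrightarrow> (\<lambda>n::int. norm (f (x + of_int n))) summable_on UNIV"
    and bound: "\<And>x. 0 \<le> x \<Longrightarrow> x < 1 \<Longrightarrow> (\<Sum>\<^sub>\<infinity>n::int. norm (f (x + of_int n))) \<le> B"
    and sum: "\<And>x. 0 \<le> x \<Longrightarrow> x < 1 \<Longrightarrow> ((\<lambda>n::int. f (x + of_int n)) has_sum K) UNIV"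
  shows "integrable lborel f" "(LINT x|lborel. f x) = K"
proof -
  \<comment> \<open>Integrals of series are indexed by naturals, so the integers are enumerated by
    \<open>int_decode\<close>. \<open>g i\<close> is \<open>f\<close> cut off to the i-th unit
    interval, and \<open>h i\<close> is the same piece moved to [0, 1).\<close>
  define e where "e i = (of_int (int_decode i) :: real)" for i
  define h where "h i x = indicator {0..<1} x *\<^sub>R f (x + e i)" for i x
  define g where "g i x = indicator {e i..<e i + 1} x *\<^sub>R f x" for i x
  have bij: "bij_betw int_decode UNIV UNIV"
    by (rule bij_int_decode)
  \<comment> \<open>A partial sum runs over finitely many distinct integers, hence is at most the
    full sum of norms.\<close>
  have fin: "(\<Sum>i<n. norm (h i x)) \<le> B * indicator {0..<1} x" for n x
  proof (cases "0 \<le> x \<and> x < 1")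
    case True
    have "(\<Sum>i<n. norm (h i x)) = (\<Sum>i<n. norm (f (x + of_int (int_decode i))))"
      using True by (simp add: h_def e_def)
    also have "\<dots> = (\<Sum>k\<in>int_decode ` {..<n}. norm (f (x + of_int k)))"
      by (subst sum.reindex) (auto intro: inj_on_subset[OF inj_int_decode])
    also have "\<dots> \<le> (\<Sum>\<^sub>\<infinity>k. norm (f (x + of_int k)))"
      using True abs by (intro finite_sum_le_infsum) auto
    also have "\<dots> \<le> B"
      using True bound by auto
    finally show ?thesis using True by simp
  qed (auto simp: h_def)
  have B: "integrable lborel (\<lambda>x. B * indicator {0..<1::real} x)"
    by (intro integrable_mult_right integrable_real_indicator) auto
  have h_int: "integrable lborel (h i)" for i
  proof (rule Bochner_Integration.integrable_bound[OF B])
    show "h i \<in> borel_measurable lborel"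
      unfolding h_def by measurable
    have "norm (h i x) \<le> norm (B * indicator {0..<1} x)" for x
    proof -
      have "norm (h i x) \<le> (\<Sum>j<Suc i. norm (h j x))"
        by (rule member_le_sum) auto
      also have "\<dots> \<le> B * indicator {0..<1} x"
        by (rule fin)
      finally show ?thesis by simp
    qed
    thus "AE x in lborel. norm (h i x) \<le> norm (B * indicator {0..<1} x)"
      by simp
  qed
  have h_AE: "summable (\<lambda>i. norm (h i x))" for x
    by (rule summableI_nonneg_bounded[OF _ fin]) auto
  have h_sum: "summable (\<lambda>i. LINT x|lborel. norm (h i x))"
  proof (rule summableI_nonneg_bounded)
    fix n
    have "(\<Sum>i<n. LINT x|lborel. norm (h i x)) = (LINT x|lborel. (\<Sum>i<n. norm (h i x)))"
      by (intro Bochner_Integration.integral_sum [symmetric] integrable_norm h_int)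
    also have "\<dots> \<le> (LINT x|lborel. B * indicator {0..<1::real} x)"
      by (intro integral_mono Bochner_Integration.integrable_sum integrable_norm h_int B fin)
    finally show "(\<Sum>i<n. LINT x|lborel. norm (h i x)) \<le> (LINT x|lborel. B * indicator {0..<1::real} x)" .
  qed auto
  have "(\<lambda>i. h i x) sums (indicator {0..<1} x *\<^sub>R K)" for x
  proof (cases "0 \<le> x \<and> x < 1")
    case True
    have "((\<lambda>i. f (x + of_int (int_decode i))) has_sum K) UNIV"
      using sum True by (subst has_sum_reindex_bij_betw[OF bij]) auto
    thus ?thesis
      using True by (simp add: h_def e_def has_sum_imp_sums)
  qed (auto simp: h_def)
  hence "(\<lambda>x. \<Sum>i. h i x) = (\<lambda>x. indicator {0..<1} x *\<^sub>R K)"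
    by (simp add: sums_iff fun_eq_iff)
  hence h_K: "(\<lambda>i. LINT x|lborel. h i x) sums K"
    using sums_integral[OF h_int, OF _ h_sum] h_AE by simp
  have shift: "h i x = g i (e i + 1 * x)" for i x
    by (auto simp: h_def g_def add.commute split: split_indicator)
  have g_int: "integrable lborel (g i)" for i
    using lborel_integrable_real_affine_iff[of 1 "g i" "e i"] h_int[of i] by (simp add: shift [abs_def])
  have gh: "(LINT x|lborel. g i x) = (LINT x|lborel. h i x)" for i
    using lborel_integral_real_affine[of 1 "g i" "e i"] by (simp add: shift)
  have gh': "(LINT x|lborel. norm (g i x)) = (LINT x|lborel. norm (h i x))" for i
    using lborel_integral_real_affine[of 1 "\<lambda>x. norm (g i x)" "e i"] by (simp add: shift)
  \<comment> \<open>Each point lies in exactly one translate, so the series of the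
    \<open>g i\<close> has a single nonzero term at most.\<close>
  have g_eq: "g i x = (if i = int_encode \<lfloor>x\<rfloor> then f x else 0)" for i x
  proof -
    have "x \<in> {e i..<e i + 1} \<longleftrightarrow> \<lfloor>x\<rfloor> = int_decode i"
      unfolding e_def by (auto simp: floor_eq_iff)
    thus ?thesis
      by (auto simp: g_def)
  qed
  have g_sums: "(\<lambda>i. g i x) sums f x" for x
    unfolding g_eq by (rule sums_single[of _ "\<lambda>_. f x"])
  have g_AE: "summable (\<lambda>i. norm (g i x))" for x
    unfolding g_eq by (rule summable_finite[of "{int_encode \<lfloor>x\<rfloor>}"]) auto
  have g_sum: "summable (\<lambda>i. LINT x|lborel. norm (g i x))"
    unfolding gh' by (rule h_sum)
  have suminf_g: "(\<lambda>x. \<Sum>i. g i x) = f"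
    using g_sums by (simp add: sums_iff fun_eq_iff)
  show "integrable lborel f"
    using integrable_suminf[OF g_int, OF _ g_sum] g_AE by (simp add: suminf_g)
  have "(\<lambda>i. LINT x|lborel. g i x) sums (LINT x|lborel. f x)"
    using sums_integral[OF g_int, OF _ g_sum] g_AE by (simp add: suminf_g)
  with h_K show "(LINT x|lborel. f x) = K"
    unfolding gh by (metis sums_unique2)
qed

section \<open>Laurent expansion of the numerator and decay of its coefficients\<close>

definition pair_coeff :: "complex \<Rightarrow> complex \<Rightarrow> complex \<Rightarrow> nat \<times> nat \<Rightarrow> complex" where
  "pair_coeff r a b = (\<lambda>(k, m). (euler_coeff r k * a ^ k) * (euler_coeff r m * b ^ m))"

text \<open>The Laurent series of (a v; r)_inf (b / v; r)_inf stays indexed by pairs: terms of equal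
  degree are not collected, so it remains a plain product of two Euler series.\<close>

definition pair_deg :: "nat \<times> nat \<Rightarrow> int" where
  "pair_deg = (\<lambda>(k, m). int k - int m)"

lemma pair_coeff_has_sum:
  assumes r: "0 < norm r" "norm r < 1" and "v \<noteq> 0"
  shows "((\<lambda>p. pair_coeff r a b p * v powi pair_deg p) has_sum qpoch (a * v) r * qpoch (b / v) r) UNIV"
    and "(\<lambda>p. norm (pair_coeff r a b p * v powi pair_deg p)) summable_on UNIV"
proof -
  have "pair_coeff r a b p * v powi pair_deg p =
      (case p of (k, m) \<Rightarrow> (euler_coeff r k * (a * v) ^ k) * (euler_coeff r m * (b / v) ^ m))" for p
    using \<open>v \<noteq> 0\<close>
    by (cases p) (simp add: pair_coeff_def pair_deg_def power_int_diff power_mult_distrib power_divide)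
  thus "((\<lambda>p. pair_coeff r a b p * v powi pair_deg p) has_sum qpoch (a * v) r * qpoch (b / v) r) UNIV"
    "(\<lambda>p. norm (pair_coeff r a b p * v powi pair_deg p)) summable_on UNIV"
    using has_sum_times[OF summable_euler[OF r, of "a * v"] euler_has_sum[OF r, of "a * v"]
        summable_euler[OF r, of "b / v"] euler_has_sum[OF r, of "b / v"]] by simp_all
qed

lemma norm_pair_coeff_le:
  assumes "0 < norm r" "norm r < 1"
  shows "\<exists>b1 b2. \<forall>k m. norm (pair_coeff r a b (k, m)) \<le>
    exp (b1 * real k + b2 * real m + ln (norm r) / 2 * (real k ^ 2 + real m ^ 2))"
proof -
  obtain b1 b2 where
    1: "norm (euler_coeff r k * a ^ k) \<le> exp (b1 * real k - (- ln (norm r) / 2) * real k ^ 2)" and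
    2: "norm (euler_coeff r k * b ^ k) \<le> exp (b2 * real k - (- ln (norm r) / 2) * real k ^ 2)" for k
    using norm_euler_coeff_le[OF assms] by meson
  have "norm (pair_coeff r a b (k, m)) \<le>
    exp (b1 * real k + b2 * real m + ln (norm r) / 2 * (real k ^ 2 + real m ^ 2))" for k m
  proof -
    have "norm (pair_coeff r a b (k, m)) = norm (euler_coeff r k * a ^ k) * norm (euler_coeff r m * b ^ m)"
      by (simp add: pair_coeff_def norm_mult)
    also have "\<dots> \<le> exp (b1 * real k - (- ln (norm r) / 2) * real k ^ 2) *
        exp (b2 * real m - (- ln (norm r) / 2) * real m ^ 2)"
      by (intro mult_mono 1 2) auto
    also have "\<dots> = exp (b1 * real k + b2 * real m + ln (norm r) / 2 * (real k ^ 2 + real m ^ 2))"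
      unfolding exp_add [symmetric] by (simp add: algebra_simps)
    finally show ?thesis .
  qed
  thus ?thesis by blast
qed

text \<open>Cauchy-Schwarz with weights; the difference of the two sides is a square over a b. With
  the weights \<alpha>1 and \<alpha>2 it brings in the constant \<alpha>1 + \<alpha>2.\<close>

lemma square_sum_le_weighted:
  fixes s t :: real
  assumes "a > 0" "b > 0"
  shows "(s + t) ^ 2 \<le> (a + b) * (s ^ 2 / a + t ^ 2 / b)"
proof -
  have "(a + b) * (s ^ 2 / a + t ^ 2 / b) - (s + t) ^ 2 = (b * s - a * t) ^ 2 / (a * b)"
    using assms by (simp add: field_simps power2_eq_square)
  moreover have "(b * s - a * t) ^ 2 / (a * b) \<ge> 0"
    using assms by simp
  ultimately show ?thesis by linarith
qed

text \<open>The nested pairs match the index set of a product of two pair expansions.\<close>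

lemma summable_on_gaussian4:
  fixes e1 e2 :: real
  assumes "e1 > 0" "e2 > 0"
  shows "(\<lambda>((k1, m1), (k2, m2)). exp (b1 * real k1 - e1 * real k1 ^ 2) * exp (b2 * real m1 - e1 * real m1 ^ 2) *
      (exp (b3 * real k2 - e2 * real k2 ^ 2) * exp (b4 * real m2 - e2 * real m2 ^ 2))) summable_on UNIV"
proof -
  have pair: "(\<lambda>p. norm (case p of (k, m) \<Rightarrow> exp (b * real k - e * real k ^ 2) * exp (b' * real m - e * real m ^ 2)))
      summable_on UNIV" if "e > 0" for b b' e :: real
  proof -
    have g: "(\<lambda>k. norm (exp (b * real k - e * real k ^ 2))) summable_on UNIV" for b
      using summable_on_gaussian_nat[OF that, of b] by simp
    have "(\<lambda>p. norm (case p of (k, m) \<Rightarrow> exp (b * real k - e * real k ^ 2) * exp (b' * real m - e * real m ^ 2)))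
        summable_on UNIV \<times> UNIV"
      by (rule has_sum_times(1)[OF g has_sum_infsum[OF abs_summable_summable[OF g]]
            g has_sum_infsum[OF abs_summable_summable[OF g]]])
    thus ?thesis by simp
  qed
  note p1 = pair[OF assms(1), of b1 b2] and p2 = pair[OF assms(2), of b3 b4]
  have "(\<lambda>p. norm (case p of (x, y) \<Rightarrow>
     (case x of (k, m) \<Rightarrow> exp (b1 * real k - e1 * real k ^ 2) * exp (b2 * real m - e1 * real m ^ 2)) *
     (case y of (k, m) \<Rightarrow> exp (b3 * real k - e2 * real k ^ 2) * exp (b4 * real m - e2 * real m ^ 2))))
     summable_on UNIV \<times> UNIV"
    by (rule has_sum_times(1)[OF p1 has_sum_infsum[OF abs_summable_summable[OF p1]]
          p2 has_sum_infsum[OF abs_summable_summable[OF p2]]])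
  hence "(\<lambda>(x, y).
     (case x of (k, m) \<Rightarrow> exp (b1 * real k - e1 * real k ^ 2) * exp (b2 * real m - e1 * real m ^ 2)) *
     (case y of (k, m) \<Rightarrow> exp (b3 * real k - e2 * real k ^ 2) * exp (b4 * real m - e2 * real m ^ 2)))
     summable_on UNIV \<times> UNIV"
    by (rule abs_summable_summable)
  thus ?thesis
    by (simp add: case_prod_unfold)
qed

text \<open>
  The coefficient of \<open>u\<^bsup>d\<^esup>\<close> in the product of the four infinite products decays like
  \<open>\<bar>q\<bar>\<^bsup>d\<^sup>2 / (2 (\<alpha>1 + \<alpha>2))\<^esup>\<close>, which beats \<open>\<bar>q\<bar>\<^bsup>- d\<^sup>2 / 2\<^esup>\<close> exactly when \<open>\<alpha>1 + \<alpha>2 < 1\<close>.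
\<close>

lemma summable_quad_coeff:
  fixes q z p1 p2 :: complex and \<alpha>1 \<alpha>2 :: real
  assumes q: "0 < norm q" "norm q < 1" and "z \<noteq> 0"
    and \<alpha>: "0 < \<alpha>1" "0 < \<alpha>2" "\<alpha>1 + \<alpha>2 < 1"
    and p1: "norm p1 = exp (ln (norm q) / \<alpha>1)" and p2: "norm p2 = exp (ln (norm q) / \<alpha>2)"
  shows "(\<lambda>(x, y). norm (pair_coeff p1 A1 B1 x * pair_coeff p2 A2 B2 y *
      q powi (- tri (pair_deg x + pair_deg y)) * z powi (- (pair_deg x + pair_deg y)))) summable_on UNIV"
proof -
  define L where "L = - ln (norm q)"
  have L: "L > 0"
    using q by (simp add: L_def ln_less_zero)
  have p: "0 < norm p1" "norm p1 < 1" "0 < norm p2" "norm p2 < 1"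
    using L \<alpha> unfolding p1 p2 by (auto simp: L_def field_simps)
  have ln_p: "ln (norm p1) = - L / \<alpha>1" "ln (norm p2) = - L / \<alpha>2"
    by (simp_all add: p1 p2 L_def)
  obtain b1 b2 where
    1: "norm (pair_coeff p1 A1 B1 (k, m)) \<le> exp (b1 * real k + b2 * real m - L / \<alpha>1 / 2 * (real k ^ 2 + real m ^ 2))"
    for k m
    using norm_pair_coeff_le[OF p(1,2), of A1 B1] unfolding ln_p by auto
  obtain b3 b4 where
    2: "norm (pair_coeff p2 A2 B2 (k, m)) \<le> exp (b3 * real k + b4 * real m - L / \<alpha>2 / 2 * (real k ^ 2 + real m ^ 2))"
    for k m
    using norm_pair_coeff_le[OF p(3,4), of A2 B2] unfolding ln_p by auto
  \<comment> \<open>\<open>\<beta>\<close> is the coefficient of d in the exponent of |q^(-d(d-1)/2)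
    z^(-d)|.\<close>
  define \<beta> where "\<beta> = - L / 2 - ln (norm z)"
  \<comment> \<open>The rates left over when L (\<alpha>1 + \<alpha>2) / (2 \<alpha>j), the cost of
    the factor |q|^(-d^2/2), is taken from the available L / (2 \<alpha>j).\<close>
  define e1 where "e1 = L * (1 - (\<alpha>1 + \<alpha>2)) / (2 * \<alpha>1)"
  define e2 where "e2 = L * (1 - (\<alpha>1 + \<alpha>2)) / (2 * \<alpha>2)"
  have e: "e1 > 0" "e2 > 0"
    using L \<alpha> by (auto simp: e1_def e2_def)
  have le: "norm (pair_coeff p1 A1 B1 (k1, m1) * pair_coeff p2 A2 B2 (k2, m2) *
      q powi (- tri (pair_deg (k1, m1) + pair_deg (k2, m2))) * z powi (- (pair_deg (k1, m1) + pair_deg (k2, m2)))) \<le>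
      exp ((b1 + \<beta>) * real k1 - e1 * real k1 ^ 2) * exp ((b2 - \<beta>) * real m1 - e1 * real m1 ^ 2) *
      (exp ((b3 + \<beta>) * real k2 - e2 * real k2 ^ 2) * exp ((b4 - \<beta>) * real m2 - e2 * real m2 ^ 2))"
    for k1 m1 k2 m2
  proof -
    define d where "d = pair_deg (k1, m1) + pair_deg (k2, m2)"
    define D where "D = (real k1 - real m1) + (real k2 - real m2)"
    define X where "X = real k1 ^ 2 + real m1 ^ 2"
    define Y where "Y = real k2 ^ 2 + real m2 ^ 2"
    have d: "of_int d = D"
      by (simp add: d_def D_def pair_deg_def)
    have "D ^ 2 \<le> (\<alpha>1 + \<alpha>2) * ((real k1 - real m1) ^ 2 / \<alpha>1 + (real k2 - real m2) ^ 2 / \<alpha>2)"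
      unfolding D_def by (rule square_sum_le_weighted) (use \<alpha> in auto)
    \<comment> \<open>Here (k - m)^2 <= k^2 + m^2, as k and m are nonnegative.\<close>
    also have "\<dots> \<le> (\<alpha>1 + \<alpha>2) * (X / \<alpha>1 + Y / \<alpha>2)"
      using \<alpha> by (intro mult_left_mono add_mono divide_right_mono) (auto simp: X_def Y_def power2_diff)
    finally have "L / 2 * D ^ 2 \<le> L / 2 * ((\<alpha>1 + \<alpha>2) * (X / \<alpha>1 + Y / \<alpha>2))"
      using L by (intro mult_left_mono) auto
    also have "\<dots> = (L / \<alpha>1 / 2 - e1) * X + (L / \<alpha>2 / 2 - e2) * Y"
      using \<alpha> by (simp add: e1_def e2_def field_simps)
    finally have D: "L / 2 * D ^ 2 \<le> (L / \<alpha>1 / 2 - e1) * X + (L / \<alpha>2 / 2 - e2) * Y" .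
    have "norm (q powi (- tri d) * z powi (- d)) = exp (L / 2 * D ^ 2 + \<beta> * D)"
      using q \<open>z \<noteq> 0\<close>
      by (simp add: norm_mult norm_power_int real_powi_eq_exp exp_add [symmetric] of_int_tri d L_def \<beta>_def field_simps)
    hence "norm (pair_coeff p1 A1 B1 (k1, m1) * pair_coeff p2 A2 B2 (k2, m2) * q powi (- tri d) * z powi (- d)) =
        norm (pair_coeff p1 A1 B1 (k1, m1)) * norm (pair_coeff p2 A2 B2 (k2, m2)) * exp (L / 2 * D ^ 2 + \<beta> * D)"
      by (simp add: norm_mult)
    also have "\<dots> \<le> exp (b1 * real k1 + b2 * real m1 - L / \<alpha>1 / 2 * X) *
        exp (b3 * real k2 + b4 * real m2 - L / \<alpha>2 / 2 * Y) *
        exp ((L / \<alpha>1 / 2 - e1) * X + (L / \<alpha>2 / 2 - e2) * Y + \<beta> * D)"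
      unfolding X_def Y_def using D by (intro mult_mono 1 2) (auto simp: X_def Y_def)
    also have "\<dots> = exp ((b1 + \<beta>) * real k1 - e1 * real k1 ^ 2) * exp ((b2 - \<beta>) * real m1 - e1 * real m1 ^ 2) *
      (exp ((b3 + \<beta>) * real k2 - e2 * real k2 ^ 2) * exp ((b4 - \<beta>) * real m2 - e2 * real m2 ^ 2))"
      unfolding exp_add [symmetric] X_def Y_def D_def by (simp add: algebra_simps)
    finally show ?thesis
      unfolding d_def .
  qed
  show ?thesis
    by (rule summable_on_comparison_test[OF summable_on_gaussian4[OF e, of "b1 + \<beta>" "b2 - \<beta>" "b3 + \<beta>" "b4 - \<beta>"]])
       (use le in auto)
qed

text \<open>The triple product transfers the shift by an arbitrary integer, negative ones included,
  from the series to the product.\<close>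

lemma theta_prod_theta_term:
  assumes q: "0 < norm q" "norm q < 1" and w: "w \<noteq> 0"
  shows "theta_prod q w = theta_term q w n * theta_prod q (w * q powi n)"
proof -
  have "w * q powi n \<noteq> 0"
    using q w by auto
  hence "qpoch q q * theta_prod q w = qpoch q q * (theta_term q w n * theta_prod q (w * q powi n))"
    using theta_series_shift[OF q w, of n] jacobi_triple_product[OF q] w by (simp add: mult_ac)
  thus ?thesis
    using qpoch_self_nonzero[OF q(2)] by simp
qed

text \<open>On the annulus |q| <= |u| <= 1 one has |u|^n <= 1 for n >= 0 and |u|^n <= |q|^n for n <
  0. This bounds the norm sums uniformly over a period of u = q^x.\<close>

lemma infsum_norm_theta_term_le:
  assumes q: "0 < norm q" "norm q < 1" and "z \<noteq> 0" and u: "norm q \<le> norm u" "norm u \<le> 1"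
  shows "(\<Sum>\<^sub>\<infinity>n. norm (theta_term q (z * u) n)) \<le>
    (\<Sum>\<^sub>\<infinity>n. norm (theta_term q z n)) + (\<Sum>\<^sub>\<infinity>n. norm (theta_term q (z * q) n))"
proof -
  have u0: "u \<noteq> 0" "q \<noteq> 0"
    using q u by auto
  have le: "norm (theta_term q (z * u) n) \<le> norm (theta_term q z n) + norm (theta_term q (z * q) n)" for n
  proof -
    have "norm u powi n \<le> 1 + norm q powi n"
    proof (cases "n \<ge> 0")
      case True
      hence "norm u powi n \<le> 1"
        using u by (simp add: power_int_nonneg_exp power_le_one)
      moreover have "0 \<le> norm q powi n"
        by simp
      ultimately show ?thesis by linarith
    next
      case False
      then obtain m where n: "n = - int m"
        by (metis int_cases2 nonneg_int_cases not_le order_refl of_nat_0_le_iff)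
      have "norm u powi n \<le> norm q powi n"
        using q u unfolding n by (simp add: power_int_minus power_mono le_imp_inverse_le)
      thus ?thesis by simp
    qed
    hence "norm (q powi tri n) * norm (z powi n) * (norm u powi n) \<le>
        norm (q powi tri n) * norm (z powi n) * (1 + norm q powi n)"
      by (intro mult_left_mono) auto
    thus ?thesis
      by (simp add: theta_term_def norm_mult norm_power_int power_int_mult_distrib algebra_simps)
  qed
  have "(\<Sum>\<^sub>\<infinity>n. norm (theta_term q (z * u) n)) \<le> (\<Sum>\<^sub>\<infinity>n. norm (theta_term q z n) + norm (theta_term q (z * q) n))"
    by (intro infsum_mono summable_on_add summable_theta_term q) (use \<open>z \<noteq> 0\<close> u0 le in auto)
  also have "\<dots> = (\<Sum>\<^sub>\<infinity>n. norm (theta_term q z n)) + (\<Sum>\<^sub>\<infinity>n. norm (theta_term q (z * q) n))"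
    by (intro infsum_add summable_theta_term q) (use \<open>z \<noteq> 0\<close> u0 in auto)
  finally show ?thesis .
qed

text \<open>Summability and integrability belong to the conclusion because \<open>infsum\<close> and
  the Bochner integral default to 0 without them.\<close>

theorem theorem5:
  fixes q lnq p1 p2 a1 a2 b1 b2 z :: complex
    and \<alpha>1 \<alpha>2 :: real
    and f :: "real \<Rightarrow> complex"
  assumes q: "0 < norm q" "norm q < 1"
    and lnq: "exp lnq = q"
    and lnq_real: "\<And>t::real. 0 < t \<Longrightarrow> t < 1 \<Longrightarrow> q = of_real t \<Longrightarrow> lnq = of_real (ln t)"
    and \<alpha>: "0 < \<alpha>1" "0 < \<alpha>2" "\<alpha>1 + \<alpha>2 < 1"
    and p1: "p1 = exp (lnq / of_real \<alpha>1)"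
    and p2: "p2 = exp (lnq / of_real \<alpha>2)"
    and a1: "qpoch (pow_of_log (lnq / of_real \<alpha>1) (a1 + 1)) p1 \<noteq> 0"
    and a2: "qpoch (pow_of_log (lnq / of_real \<alpha>2) (a2 + 1)) p2 \<noteq> 0"
    and z: "z \<noteq> 0" "z \<notin> {- pow_of_log lnq (of_real x) | x :: real. True}"
    and f: "\<And>x. f x =
      qbinom (lnq / of_real \<alpha>1) a1 (b1 + of_real \<alpha>1 * of_real x) *
      qbinom (lnq / of_real \<alpha>2) a2 (b2 + of_real \<alpha>2 * of_real x) *
      (1 / (qpoch (- z * pow_of_log lnq (of_real x)) q *
            qpoch (- pow_of_log lnq (1 - of_real x) / z) q))"
  shows "(\<lambda>n::int. f (of_int n)) summable_on UNIV \<and>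
         integrable lborel f \<and>
         (\<Sum>\<^sub>\<infinity>n::int. f (of_int n)) = (LINT x|lborel. f x)"
proof -
  have q0: "q \<noteq> 0"
    using q by auto
  have ln_q: "Re lnq = ln (norm q)"
    by (simp flip: lnq)
  have ln_neg: "ln (norm q) < 0"
    using q by (simp add: ln_less_zero)
  have norm_p: "norm p1 = exp (ln (norm q) / \<alpha>1)" "norm p2 = exp (ln (norm q) / \<alpha>2)"
    by (simp_all add: p1 p2 ln_q)
  have p: "0 < norm p1" "norm p1 < 1" "0 < norm p2" "norm p2 < 1"
    using ln_neg \<alpha> unfolding norm_p by (auto simp: divide_neg_pos)
  define U where "U x = exp (of_real x * lnq)" for x :: real
  have U0: "U x \<noteq> 0" for x
    by (simp add: U_def)
  have U_add: "U (x + y) = U x * U y" for x y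
    by (simp add: U_def exp_add ring_distribs)
  have U_int: "U (of_int n) = q powi n" for n
    unfolding U_def lnq [symmetric] by (simp add: exp_power_int)
  have norm_U: "norm (U x) = exp (x * ln (norm q))" for x
    by (simp add: U_def ln_q)

  \<comment> \<open>The arguments of the four numerator products at x = 0. Since pj^(\<alpha>j x) =
    q^x, a general x multiplies or divides them by u = q^x.\<close>
  define A1 B1 A2 B2 where
    "A1 = exp ((b1 + 1) * (lnq / of_real \<alpha>1))" and "B1 = exp ((a1 - b1 + 1) * (lnq / of_real \<alpha>1))" and
    "A2 = exp ((b2 + 1) * (lnq / of_real \<alpha>2))" and "B2 = exp ((a2 - b2 + 1) * (lnq / of_real \<alpha>2))"
  define N where "N v = (qpoch (A1 * v) p1 * qpoch (B1 / v) p1) * (qpoch (A2 * v) p2 * qpoch (B2 / v) p2)" for v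
  define C where "C = 1 / ((qpoch p1 p1 * qpoch (pow_of_log (lnq / of_real \<alpha>1) (a1 + 1)) p1) *
     (qpoch p2 p2 * qpoch (pow_of_log (lnq / of_real \<alpha>2) (a2 + 1)) p2))"
  have pow_plus: "pow_of_log (lnq / of_real \<alpha>) (b + of_real \<alpha> * of_real x + 1) = exp ((b + 1) * (lnq / of_real \<alpha>)) * U x"
    and pow_minus: "pow_of_log (lnq / of_real \<alpha>) (a - (b + of_real \<alpha> * of_real x) + 1) =
      exp ((a - b + 1) * (lnq / of_real \<alpha>)) / U x" if "\<alpha> > 0" for \<alpha> x :: real and a b
    using that by (simp_all add: pow_of_log_def U_def exp_add [symmetric] exp_diff [symmetric] field_simps)
  have f_eq: "f x = C * N (U x) / theta_prod q (z * U x)" for x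
  proof -
    have "pow_of_log lnq (of_real x) = U x" "pow_of_log lnq (1 - of_real x) = q / U x"
      by (simp_all add: pow_of_log_def U_def left_diff_distrib exp_diff lnq)
    thus ?thesis
      unfolding f qbinom_def pow_plus[OF \<alpha>(1)] pow_plus[OF \<alpha>(2)] pow_minus[OF \<alpha>(1)] pow_minus[OF \<alpha>(2)]
        p1 [symmetric] p2 [symmetric]
      by (simp add: C_def N_def A1_def A2_def B1_def B2_def theta_prod_def mult_ac)
  qed

  \<comment> \<open>A vanishing factor would force z = -q^(-x-k) or z = -q^(k+1-x), both excluded by
    the hypothesis on \<open>z\<close>.\<close>
  have theta_nz: "theta_prod q (z * U x) \<noteq> 0" for x
  proof -
    have z': "z \<noteq> - U y" for y
      using z(2) by (auto simp: pow_of_log_def U_def)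
    have "- (z * U x) * q ^ k \<noteq> 1" for k
    proof
      assume *: "- (z * U x) * q ^ k = 1"
      have "- (z * U x) * q ^ k * U (- x - real k) = - z * U (x + real k + (- x - real k))"
        unfolding U_add using U_int[of "int k"] by (simp add: mult_ac)
      hence "U (- x - real k) = - z"
        unfolding * by (simp add: U_def)
      thus False using z'[of "- x - real k"] by simp
    qed
    moreover have "- q / (z * U x) * q ^ k \<noteq> 1" for k
    proof
      assume "- q / (z * U x) * q ^ k = 1"
      hence "z * U x = - (q ^ Suc k)"
        using z(1) U0[of x] by (simp add: field_simps)
      moreover have "U (real (Suc k)) = q ^ Suc k"
        using U_int[of "int (Suc k)"] by (simp only: of_int_of_nat_eq power_int_of_nat)
      ultimately have "z * U x = - U (real (Suc k))"
        by simp
      hence "z * U x * U (- x) = - U (real (Suc k)) * U (- x)"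
        by simp
      hence "z * U (x + - x) = - U (real (Suc k) + - x)"
        unfolding U_add by (simp add: mult_ac)
      thus False using z'[of "real (Suc k) + - x"] by (simp add: U_def)
    qed
    ultimately show ?thesis
      unfolding theta_prod_def by (simp add: qpoch_eq_0_iff[OF q(2)])
  qed

  \<comment> \<open>Coefficients and degrees of the Laurent expansion of \<open>N\<close>, indexed
    by pairs of pairs.\<close>
  define c where "c = (\<lambda>(x, y). pair_coeff p1 A1 B1 x * pair_coeff p2 A2 B2 y)"
  define d where "d = (\<lambda>(x, y). pair_deg x + pair_deg y)"
  define K where "K i = c i * q powi (- tri (d i)) * z powi (- d i)" for i
  have K: "(\<lambda>i. norm (K i)) summable_on UNIV"
    using summable_quad_coeff[OF q z(1) \<alpha> norm_p, of A1 B1 A2 B2]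
    by (simp add: K_def c_def d_def case_prod_unfold)
  have N: "((\<lambda>i. c i * v powi d i) has_sum N v) UNIV" if "v \<noteq> 0" for v
  proof -
    have "((\<lambda>(x, y). (pair_coeff p1 A1 B1 x * v powi pair_deg x) * (pair_coeff p2 A2 B2 y * v powi pair_deg y))
        has_sum N v) (UNIV \<times> UNIV)"
      unfolding N_def
      by (rule has_sum_times(2)[OF pair_coeff_has_sum(2,1)[OF p(1,2) that] pair_coeff_has_sum(2,1)[OF p(3,4) that]])
    thus ?thesis
      using that by (simp add: c_def d_def case_prod_unfold power_int_add mult_ac)
  qed
  note swap = laurent_theta_has_sum[OF q z(1) U0 K[unfolded K_def] N, folded K_def]

  \<comment> \<open>Quasi-periodicity turns the shifted theta in the denominator into a theta term
    in the numerator, the form treated by the double series lemma.\<close>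
  have f_shift: "f (x + of_int n) =
      C / theta_prod q (z * U x) * (N (U x * q powi n) * theta_term q (z * U x) n)" for x n
  proof -
    have zU: "z * U x \<noteq> 0"
      using z U0 by simp
    have "theta_prod q (z * U x) = theta_term q (z * U x) n * theta_prod q (z * (U x * q powi n))"
      using theta_prod_theta_term[OF q zU, of n] by (simp add: mult_ac)
    thus ?thesis
      using theta_nz[of x] unfolding f_eq U_add U_int by (simp add: field_simps)
  qed

  define S where "S = C * qpoch q q * infsum K UNIV"
  \<comment> \<open>The theta series produced by the double sum cancels the denominator, so the
    value \<open>S\<close> is free of \<open>x\<close>.\<close>
  have f_sum: "((\<lambda>n::int. f (x + of_int n)) has_sum S) UNIV" for x
  proof -
    have "((\<lambda>n::int. f (x + of_int n)) has_sum
        C / theta_prod q (z * U x) * (theta_series q (z * U x) * infsum K UNIV)) UNIV"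
      unfolding f_shift by (intro has_sum_cmult_right swap(1))
    moreover have "theta_series q (z * U x) = qpoch q q * theta_prod q (z * U x)"
      by (rule jacobi_triple_product[OF q]) (use z U0 in simp)
    ultimately show ?thesis
      using theta_nz[of x] by (simp add: S_def mult_ac)
  qed
  have f_abs: "(\<lambda>n::int. norm (f (x + of_int n))) summable_on UNIV" for x
    unfolding f_shift norm_mult[of "C / theta_prod q (z * U x)"]
    by (intro summable_on_cmult_right swap(2))

  have U_cont: "continuous_on X U" for X
    unfolding U_def by (intro continuous_intros)
  have theta_cont: "continuous_on X (\<lambda>x. theta_prod q (z * U x))" for X
    unfolding theta_prod_def using z U0 by (intro continuous_intros q U_cont) auto
  have "continuous_on UNIV f"
    unfolding f_eq [abs_def] N_def using theta_nz U0 by (intro continuous_intros p U_cont theta_cont) auto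
  hence f_meas: "f \<in> borel_measurable borel"
    by (rule borel_measurable_continuous_onI)

  \<comment> \<open>A continuous function without zeros on a compact interval stays away from 0; the
    minimum at \<open>x0\<close> bounds the denominator in \<open>B\<close>.\<close>
  have "\<exists>x\<in>{0..1}. \<forall>y\<in>{0..1}. norm (theta_prod q (z * U x)) \<le> norm (theta_prod q (z * U y))"
    by (rule continuous_attains_inf) (auto intro!: continuous_on_norm theta_cont)
  then obtain x0 where
    x0: "\<And>y. 0 \<le> y \<Longrightarrow> y \<le> 1 \<Longrightarrow> norm (theta_prod q (z * U x0)) \<le> norm (theta_prod q (z * U y))"
    by (metis atLeastAtMost_iff)
  define B where "B = norm C / norm (theta_prod q (z * U x0)) *
    (((\<Sum>\<^sub>\<infinity>n. norm (theta_term q z n)) + (\<Sum>\<^sub>\<infinity>n. norm (theta_term q (z * q) n))) * (\<Sum>\<^sub>\<infinity>i. norm (K i)))"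
  have f_bound: "(\<Sum>\<^sub>\<infinity>n::int. norm (f (x + of_int n))) \<le> B" if x: "0 \<le> x" "x < 1" for x
  proof -
    \<comment> \<open>For x in [0, 1) the point q^x lies in the annulus where the theta norm sums
      are uniformly bounded.\<close>
    have "ln (norm q) \<le> x * ln (norm q)"
      using x ln_neg by (simp add: mult_le_cancel_right1)
    hence "exp (ln (norm q)) \<le> exp (x * ln (norm q))"
      by simp
    hence u: "norm q \<le> norm (U x)" "norm (U x) \<le> 1"
      using x ln_neg q(1) unfolding norm_U by (auto simp: mult_nonneg_nonpos simp del: zero_less_norm_iff)
    have "(\<Sum>\<^sub>\<infinity>n::int. norm (f (x + of_int n))) = norm C / norm (theta_prod q (z * U x)) *
        (\<Sum>\<^sub>\<infinity>n. norm (N (U x * q powi n) * theta_term q (z * U x) n))"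
      unfolding f_shift norm_mult[of "C / theta_prod q (z * U x)"] norm_divide by (rule infsum_cmult_right')
    also have "\<dots> \<le> B"
      unfolding B_def
    proof (intro mult_mono divide_left_mono)
      show "(\<Sum>\<^sub>\<infinity>n. norm (N (U x * q powi n) * theta_term q (z * U x) n)) \<le>
        ((\<Sum>\<^sub>\<infinity>n. norm (theta_term q z n)) + (\<Sum>\<^sub>\<infinity>n. norm (theta_term q (z * q) n))) * (\<Sum>\<^sub>\<infinity>i. norm (K i))"
        by (rule order_trans[OF swap(3) mult_right_mono[OF infsum_norm_theta_term_le[OF q z(1) u]]])
           (auto intro: infsum_nonneg)
    qed (use x x0[of x] theta_nz in \<open>auto intro!: infsum_nonneg mult_pos_pos\<close>)
    finally show ?thesis .
  qed

  note integral = integral_eq_periodization[OF f_meas f_abs f_bound f_sum]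
  have "((\<lambda>n::int. f (of_int n)) has_sum S) UNIV"
    using f_sum[of 0] by simp
  thus ?thesis
    using integral by (auto simp: summable_on_def infsumI)
qed

end
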